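(* Let $P$ be a point that does not lie on the extended sides of triangle $ABC$ or of its anticomplementary triangle. Then the commutator $\mathcal{S}'=T_{P'}T_PT_{P'}^{-1}T_P^{-1}$ is always a translation, in the direction of the line $PP'$: if $P$ and $P'$ are ordinary, it is a translation by the distance $|T_P(P')P'|=|PT_{P'}(P)|$; if $P$ or $P'$ is infinite, it is a translation by the distance $3|G_1G|$, where $G_1=T_P(G)$. (If $P=P'=G$ the translation distance is $0$ and the direction condition is void.)
   Context: Work in the extended Euclidean plane: the Euclidean plane together with the line at infinity $l_\infty$. Points on $l_\infty$ are called infinite, all other points ordinary; affine maps are extended to $l_\infty$. $XY$ denotes the line through $X$ and $Y$, $|XY|$ the length of the segment $XY$, and $l\cdot m$ the intersection point of lines $l$ and $m$. The identity counts as a translation. $ABC$ is a (nondegenerate) triangle with centroid $G$. $K$ is the homothety with center $G$ and ratio $-1/2$; the anticomplementary triangle is $K^{-1}(ABC)$. $P$ may be ordinary or infinite, and may lie on a median. $D=AP\cdot BC$, $E=BP\cdot CA$, $F=CP\cdot AB$ are the traces of $P$, and $D_3,E_3,F_3$ are their reflections in the midpoints of $BC,CA,AB$ respectively; the lines $AD_3,BE_3,CF_3$ meet in the isotomic conjugate $P'$ of $P$. $T_P$ is the unique affine map with $A\mapsto D$, $B\mapsto E$, $C\mapsto F$; $T_{P'}$ is the unique affine map with $A\mapsto D_3$, $B\mapsto E_3$, $C\mapsto F_3$. Products of maps denote composition, right factor applied first. *)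

theory Defs
  imports "HOL-Analysis.Analysis"
begin

section \<open>The extended Euclidean plane\<close>

text \<open>A point at infinity is a parallel class of lines, represented by the common
  one-dimensional direction space of its members.\<close>

typedef direction = "{U :: (real^2) set. subspace U \<and> dim U = 1}"
proof
  show "span {axis 1 1} \<in> {U :: (real^2) set. subspace U \<and> dim U = 1}"
    by (simp add: dim_singleton axis_eq_0_iff)
qed

datatype ext_point = Ordinary "real^2" | Infinite direction

definition line_at_infinity :: "ext_point set" where
  "line_at_infinity = range Infinite"

text \<open>The line through the ordinary point \<open>a\<close> with direction vector \<open>d\<close>, together with its point
  at infinity; meaningful for \<open>d \<noteq> 0\<close> only.\<close>

definition ordinary_line :: "real^2 \<Rightarrow> real^2 \<Rightarrow> ext_point set" where
  "ordinary_line a d =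
     insert (Infinite (Abs_direction (span {d}))) (range (\<lambda>t. Ordinary (a + t *\<^sub>R d)))"

definition is_line :: "ext_point set \<Rightarrow> bool" where
  "is_line l \<longleftrightarrow> l = line_at_infinity \<or> (\<exists>a d. d \<noteq> 0 \<and> l = ordinary_line a d)"

definition join :: "ext_point \<Rightarrow> ext_point \<Rightarrow> ext_point set" where
  "join X Y = (THE l. is_line l \<and> X \<in> l \<and> Y \<in> l)"

definition meet :: "ext_point set \<Rightarrow> ext_point set \<Rightarrow> ext_point" where
  "meet l m = (THE X. X \<in> l \<and> X \<in> m)"

text \<open>The vector \<open>v\<close> points along the ordinary line \<open>l\<close>; the zero vector points along every
  ordinary line.\<close>

definition along :: "real^2 \<Rightarrow> ext_point set \<Rightarrow> bool" where
  "along v l \<longleftrightarrow> (\<exists>a d. d \<noteq> 0 \<and> l = ordinary_line a d \<and> v \<in> span {d})"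


section \<open>Affine maps\<close>

definition affine_map :: "(real^2 \<Rightarrow> real^2) \<Rightarrow> bool" where
  "affine_map f \<longleftrightarrow> (\<exists>L b. linear L \<and> f = (\<lambda>x. L x + b))"

text \<open>The affine map with \<open>A \<mapsto> X\<close>, \<open>B \<mapsto> Y\<close>, \<open>C \<mapsto> Z\<close>; meaningful only if \<open>X\<close>, \<open>Y\<close>, \<open>Z\<close> are
  ordinary and \<open>A\<close>, \<open>B\<close>, \<open>C\<close> are not collinear.\<close>

definition affine_map_of ::
    "real^2 \<Rightarrow> real^2 \<Rightarrow> real^2 \<Rightarrow> ext_point \<Rightarrow> ext_point \<Rightarrow> ext_point \<Rightarrow> real^2 \<Rightarrow> real^2" where
  "affine_map_of A B C X Y Z =
     (THE f. affine_map f \<and> Ordinary (f A) = X \<and> Ordinary (f B) = Y \<and> Ordinary (f C) = Z)"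

definition homothety :: "real^2 \<Rightarrow> real \<Rightarrow> real^2 \<Rightarrow> real^2" where
  "homothety c r x = c + r *\<^sub>R (x - c)"

text \<open>The half-turn about \<open>M\<close> fixes every point at infinity.\<close>

fun reflect_in :: "real^2 \<Rightarrow> ext_point \<Rightarrow> ext_point" where
  "reflect_in M (Ordinary X) = Ordinary (2 *\<^sub>R M - X)"
| "reflect_in M (Infinite d) = Infinite d"


section \<open>Triangle geometry\<close>

definition centroid :: "real^2 \<Rightarrow> real^2 \<Rightarrow> real^2 \<Rightarrow> real^2" where
  "centroid A B C = (1/3) *\<^sub>R (A + B + C)"

definition extended_sides :: "real^2 \<Rightarrow> real^2 \<Rightarrow> real^2 \<Rightarrow> ext_point set" where
  "extended_sides A B C =
     join (Ordinary B) (Ordinary C) \<union> join (Ordinary C) (Ordinary A) \<union> join (Ordinary A) (Ordinary B)"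

definition anticomplement :: "real^2 \<Rightarrow> real^2 \<Rightarrow> real^2 \<Rightarrow> real^2 \<Rightarrow> real^2" where
  "anticomplement A B C = inv (homothety (centroid A B C) (-1/2))"

text \<open>In the next two definitions the first vertex is the one the cevian passes through, so the
  three traces on \<open>BC\<close>, \<open>CA\<close>, \<open>AB\<close> arise by cyclic permutation of the vertices.\<close>

definition trace_point :: "real^2 \<Rightarrow> real^2 \<Rightarrow> real^2 \<Rightarrow> ext_point \<Rightarrow> ext_point" where
  "trace_point A B C P = meet (join (Ordinary A) P) (join (Ordinary B) (Ordinary C))"

definition reflected_trace :: "real^2 \<Rightarrow> real^2 \<Rightarrow> real^2 \<Rightarrow> ext_point \<Rightarrow> ext_point" where
  "reflected_trace A B C P = reflect_in (midpoint B C) (trace_point A B C P)"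

definition isotomic_conjugate :: "real^2 \<Rightarrow> real^2 \<Rightarrow> real^2 \<Rightarrow> ext_point \<Rightarrow> ext_point" where
  "isotomic_conjugate A B C P =
     (THE X. X \<in> join (Ordinary A) (reflected_trace A B C P)
           \<and> X \<in> join (Ordinary B) (reflected_trace B C A P)
           \<and> X \<in> join (Ordinary C) (reflected_trace C A B P))"

definition cevian_map :: "real^2 \<Rightarrow> real^2 \<Rightarrow> real^2 \<Rightarrow> ext_point \<Rightarrow> real^2 \<Rightarrow> real^2" where
  "cevian_map A B C P =
     affine_map_of A B C (trace_point A B C P) (trace_point B C A P) (trace_point C A B P)"

definition reflected_cevian_map :: "real^2 \<Rightarrow> real^2 \<Rightarrow> real^2 \<Rightarrow> ext_point \<Rightarrow> real^2 \<Rightarrow> real^2" where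
  "reflected_cevian_map A B C P =
     affine_map_of A B C (reflected_trace A B C P) (reflected_trace B C A P) (reflected_trace C A B P)"

end

theory Submission
  imports Defs
begin

text \<open>The whole theorem is a computation in barycentric coordinates. Write \<open>P = (p : q : r)\<close>, so that
  \<open>P' = (qr : rp : pq)\<close>, \<open>D = (0 : q : r)\<close> and \<open>D\<^sub>3 = (0 : r : q)\<close>. The hypotheses say exactly that
  \<open>p, q, r\<close> and \<open>q + r, r + p, p + q\<close> are nonzero; hence all six traces are ordinary, and \<open>T\<^sub>P\<close> and
  \<open>T\<^sub>P\<^sub>'\<close> become explicit matrices, the second being the first with \<open>P'\<close> in place of \<open>P\<close>
  (\<open>cevian_map\<close>, \<open>reflected_cevian_map_eq\<close>). Both are invertible.

  It suffices that \<open>T\<^sub>P\<^sub>' T\<^sub>P X - T\<^sub>P T\<^sub>P\<^sub>' X\<close> is one fixed vector \<open>w\<close> for all \<open>X\<close>: then the commutator is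
  the translation by \<open>w\<close>. The difference is affine in \<open>X\<close>, so it is enough to look at the vertices,
  and there it is the vector with coordinates
  \<open>w = (s (qr, rp, pq) - t (p, q, r)) / ((p + q) (q + r) (r + p))\<close>,
  where \<open>s = p + q + r\<close> and \<open>t = qr + rp + pq\<close>. This is a computation for \<open>X = A\<close>; it then holds for
  \<open>B\<close> and \<open>C\<close> because the expression is equivariant under cyclic permutation (\<open>shift\<close>,
  \<open>commutator\<close>).

  The remaining claims can be read off from this formula. As a combination of the coordinate
  vectors of \<open>P\<close> and \<open>P'\<close>, the point at infinity that a nonzero \<open>w\<close> represents lies on the line \<open>PP'\<close>, also when
  \<open>P\<close> or \<open>P'\<close> is itself infinite (\<open>shift_along_PP'\<close>). Evaluating the matrices at three particular
  points gives \<open>T\<^sub>P(P') = P' - w\<close>, \<open>T\<^sub>P\<^sub>'(P) = P + w\<close> and \<open>T\<^sub>P(G) = G - w/3\<close>, hence the distances.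

  Incidences in the extended plane are treated as linear algebra in \<open>\<real>\<^sup>3\<close>: points and
  lines are both given by nonzero coordinate vectors up to scaling, a point lies on a line iff the
  inner product vanishes, and joins and meets are cross products (\<open>join_bary\<close>, \<open>meet_bline\<close>).\<close>

unbundle cross3_syntax


section \<open>Barycentric coordinates\<close>

text \<open>Coordinate vectors of mass \<open>1\<close> give points as weighted means of \<open>A\<close>, \<open>B\<close>, \<open>C\<close>; those of mass
  \<open>0\<close> give vectors of the plane, in a way that does not depend on an origin.\<close>

definition mass :: "real^3 \<Rightarrow> real" where
  "mass v = v$1 + v$2 + v$3"

definition comb :: "real^2 \<Rightarrow> real^2 \<Rightarrow> real^2 \<Rightarrow> real^3 \<Rightarrow> real^2" where
  "comb A B C v = v$1 *\<^sub>R A + v$2 *\<^sub>R B + v$3 *\<^sub>R C"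

definition bary :: "real^2 \<Rightarrow> real^2 \<Rightarrow> real^2 \<Rightarrow> real^3 \<Rightarrow> ext_point" where
  "bary A B C v =
     (if mass v = 0 then Infinite (Abs_direction (span {comb A B C v}))
      else Ordinary ((1 / mass v) *\<^sub>R comb A B C v))"

definition bline :: "real^2 \<Rightarrow> real^2 \<Rightarrow> real^2 \<Rightarrow> real^3 \<Rightarrow> ext_point set" where
  "bline A B C u = {bary A B C v | v. v \<noteq> 0 \<and> u \<bullet> v = 0}"

lemma eq_zero_3: "v = 0 \<longleftrightarrow> v$1 = 0 \<and> v$2 = 0 \<and> v$3 = 0" for v :: "real^3"
  by (simp add: vec_eq_iff forall_3)

lemma mass_zero [simp]: "mass 0 = 0"
  by (simp add: mass_def)

lemma mass_scale [simp]: "mass (c *\<^sub>R v) = c * mass v"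
  and mass_add: "mass (v + w) = mass v + mass w"
  and mass_diff: "mass (v - w) = mass v - mass w"
  by (auto simp: mass_def algebra_simps)

lemma comb_scale [simp]: "comb A B C (c *\<^sub>R v) = c *\<^sub>R comb A B C v"
  and comb_add: "comb A B C (v + w) = comb A B C v + comb A B C w"
  and comb_diff: "comb A B C (v - w) = comb A B C v - comb A B C w"
  by (auto simp: comb_def algebra_simps)

lemma affine_map_comb:
  assumes "affine_map f" "mass v = 1"
  shows "f (comb X Y Z v) = comb (f X) (f Y) (f Z) v"
proof -
  obtain L b where L: "linear L" "f = (\<lambda>x. L x + b)" using assms(1) unfolding affine_map_def by blast
  have "b = (v$1 + v$2 + v$3) *\<^sub>R b" using assms(2) by (simp add: mass_def)
  then show ?thesis
    by (simp add: L comb_def linear_add linear_scale algebra_simps)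
qed

lemma collinear_iff_affine_relation:
  "collinear {A, B, C} \<longleftrightarrow> (\<exists>v. v \<noteq> 0 \<and> mass v = 0 \<and> comb A B C v = 0)"
proof -
  have edges: "collinear {A, B, C} \<longleftrightarrow> collinear {0, A - B, C - B}"
    by (rule collinear_3) (simp add: NO_MATCH_def)
  show ?thesis
  proof
    assume "collinear {A, B, C}"
    then consider "A = B" | "C = B" | k where "C - B = k *\<^sub>R (A - B)"
      by (auto simp: edges collinear_lemma)
    then show "\<exists>v. v \<noteq> 0 \<and> mass v = 0 \<and> comb A B C v = 0"
    proof cases
      case 1
      then show ?thesis
        by (intro exI[of _ "vector [1, -1, 0]"]) (simp add: eq_zero_3 mass_def comb_def)
    next
      case 2
      then show ?thesis
        by (intro exI[of _ "vector [0, 1, -1]"]) (simp add: eq_zero_3 mass_def comb_def)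
    next
      case 3
      then have "C = B + k *\<^sub>R (A - B)"
        by (simp add: algebra_simps)
      then show ?thesis
        by (intro exI[of _ "vector [k, 1 - k, -1]"])
          (simp add: eq_zero_3 mass_def comb_def algebra_simps)
    qed
  next
    assume "\<exists>v. v \<noteq> 0 \<and> mass v = 0 \<and> comb A B C v = 0"
    then obtain v where v: "v \<noteq> 0" "mass v = 0" "comb A B C v = 0"
      by blast
    from v(2) have m: "v$2 = - v$1 - v$3"
      by (simp add: mass_def)
    with v(3) have rel: "v$1 *\<^sub>R (A - B) + v$3 *\<^sub>R (C - B) = 0"
      by (simp add: comb_def algebra_simps)
    have "A - B = 0 \<or> C - B = 0 \<or> (\<exists>k. C - B = k *\<^sub>R (A - B))"
    proof (cases "v$3 = 0")
      case True
      with rel m v(1) show ?thesis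
        by (auto simp: eq_zero_3)
    next
      case False
      have "v$3 *\<^sub>R (C - B) = (- v$1) *\<^sub>R (A - B)"
        using rel by (simp add: add_eq_0_iff)
      then have "(1 / v$3) *\<^sub>R v$3 *\<^sub>R (C - B) = (1 / v$3) *\<^sub>R (- v$1) *\<^sub>R (A - B)"
        by simp
      then have "C - B = (- v$1 / v$3) *\<^sub>R (A - B)"
        using False by simp
      then show ?thesis by blast
    qed
    then show "collinear {A, B, C}"
      by (auto simp: edges collinear_lemma)
  qed
qed

locale triangle =
  fixes A B C :: "real^2"
  assumes noncollinear: "\<not> collinear {A, B, C}"
begin

lemma comb_eq_zero: "mass v = 0 \<Longrightarrow> comb A B C v = 0 \<Longrightarrow> v = 0"
  using noncollinear collinear_iff_affine_relation by blast

text \<open>So \<open>A - B\<close> and \<open>C - B\<close> form a basis of the plane. This yields barycentric coordinates for every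
  point (\<open>ex_comb\<close>) and the existence of affine maps with prescribed values at the vertices.\<close>

lemma edge_vectors_linear_inj:
  "linear (\<lambda>y :: real^2. y$1 *\<^sub>R (A - B) + y$2 *\<^sub>R (C - B))" (is "linear ?L")
  "inj (\<lambda>y :: real^2. y$1 *\<^sub>R (A - B) + y$2 *\<^sub>R (C - B))"
proof -
  show lin: "linear ?L"
    by (intro linearI) (simp_all add: algebra_simps)
  have "y = 0" if "?L y = 0" for y :: "real^2"
  proof -
    have "vector [y$1, - y$1 - y$2, y$2] = (0 :: real^3)"
      using that by (intro comb_eq_zero) (simp_all add: mass_def comb_def algebra_simps)
    then have "y$1 = 0" "y$2 = 0"
      by (simp_all add: eq_zero_3)
    then show ?thesis
      by (simp add: vec_eq_iff forall_2)
  qed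
  then show "inj ?L"
    using linear_injective_0[OF lin] by blast
qed

lemma ex_comb: "\<exists>v. mass v = s \<and> comb A B C v = w"
proof -
  let ?L = "\<lambda>y :: real^2. y$1 *\<^sub>R (A - B) + y$2 *\<^sub>R (C - B)"
  have surj: "surj ?L"
    by (rule linear_injective_imp_surjective[OF edge_vectors_linear_inj refl])
  obtain y where "w - s *\<^sub>R B = ?L y"
    using surjD[OF surj, of "w - s *\<^sub>R B"] by blast
  then show ?thesis
    by (intro exI[of _ "vector [y$1, s - y$1 - y$2, y$2]"])
      (simp add: mass_def comb_def algebra_simps)
qed

end

section \<open>Points at infinity and the projective point of a coordinate vector\<close>

lemma direction_span [simp]:
  "w \<noteq> 0 \<Longrightarrow> Rep_direction (Abs_direction (span {w})) = span {w}"
  by (rule Abs_direction_inverse) (simp add: subspace_span)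

lemma direction_cases:
  obtains w where "w \<noteq> 0" "d = Abs_direction (span {w})"
proof -
  have d: "subspace (Rep_direction d)" "dim (Rep_direction d) = 1"
    using Rep_direction[of d] by auto
  then have "\<not> Rep_direction d \<subseteq> {0}"
    using dim_eq_0[of "Rep_direction d"] by auto
  then obtain w where w: "w \<in> Rep_direction d" "w \<noteq> 0"
    by auto
  have "span {w} = span (Rep_direction d)"
    using w d by (intro subspace_dim_equal span_mono) (auto simp: subspace_span)
  then have "span {w} = Rep_direction d"
    using d(1) by (simp add: span_eq_iff)
  then show ?thesis
    using that w(2) by (simp add: Rep_direction_inverse)
qed

lemma direction_span_eq_iff:
  assumes "v \<noteq> 0" "w \<noteq> 0"
  shows "Abs_direction (span {v}) = Abs_direction (span {w}) \<longleftrightarrow> (\<exists>k. v = k *\<^sub>R w)"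
proof
  assume "Abs_direction (span {v}) = Abs_direction (span {w})"
  then have "span {v} = span {w}"
    using assms by (metis direction_span)
  then have "v \<in> span {w}"
    by (metis span_base singletonI)
  then show "\<exists>k. v = k *\<^sub>R w"
    by (auto simp: span_singleton)
next
  assume "\<exists>k. v = k *\<^sub>R w"
  then obtain k where k: "v = k *\<^sub>R w" by blast
  then have "w = (1 / k) *\<^sub>R v" using assms by auto
  with k have "v \<in> span {w}" "w \<in> span {v}"
    by (metis span_base span_scale singletonI)+
  then have "span {v} = span {w}"
    by (meson empty_subsetI insert_subset span_minimal subset_antisym subspace_span)
  then show "Abs_direction (span {v}) = Abs_direction (span {w})" by simp
qed

lemma cross_zero_imp_scale:
  assumes "v \<times> w = 0" "v \<noteq> 0" "w \<noteq> 0"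
  obtains k where "k \<noteq> 0" "v = k *\<^sub>R w"
proof -
  obtain c where c: "w = c *\<^sub>R v"
    using assms by (auto simp: cross_eq_0 collinear_lemma)
  show ?thesis
    by (rule that[of "1 / c"]) (use c assms in auto)
qed

lemma orthogonal_imp_parallel_cross:
  assumes "u \<bullet> v = 0" "u \<bullet> w = 0" "u \<noteq> 0" "v \<times> w \<noteq> 0"
  obtains k where "k \<noteq> 0" "u = k *\<^sub>R (v \<times> w)"
proof -
  have "u \<times> (v \<times> w) = 0"
    by (simp add: Lagrange assms)
  then show ?thesis using cross_zero_imp_scale assms that by blast
qed

context triangle begin

lemma bary_scale: "k \<noteq> 0 \<Longrightarrow> v \<noteq> 0 \<Longrightarrow> bary A B C (k *\<^sub>R v) = bary A B C v"
  using comb_eq_zero[of v] direction_span_eq_iff[of "k *\<^sub>R comb A B C v" "comb A B C v"]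
  by (cases "mass v = 0") (auto simp: bary_def)

lemma bary_eq_iff:
  assumes "v \<noteq> 0" "w \<noteq> 0"
  shows "bary A B C v = bary A B C w \<longleftrightarrow> v \<times> w = 0"
proof
  assume "v \<times> w = 0"
  then show "bary A B C v = bary A B C w"
    using cross_zero_imp_scale assms bary_scale by metis
next
  assume eq: "bary A B C v = bary A B C w"
  show "v \<times> w = 0"
  proof (cases "mass v = 0")
    case True
    then have w0: "mass w = 0" using eq by (auto simp: bary_def split: if_splits)
    then have "comb A B C v \<noteq> 0" "comb A B C w \<noteq> 0"
      using True assms comb_eq_zero by auto
    then obtain k where "comb A B C v = k *\<^sub>R comb A B C w"
      using eq True w0 by (auto simp: bary_def direction_span_eq_iff)
    then have "v - k *\<^sub>R w = 0"
      using True w0 by (intro comb_eq_zero) (simp_all add: mass_diff comb_diff)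
    then show ?thesis by (simp add: cross_mult_left)
  next
    case False
    then have w0: "mass w \<noteq> 0" using eq by (auto simp: bary_def split: if_splits)
    have c: "(1 / mass v) *\<^sub>R comb A B C v = (1 / mass w) *\<^sub>R comb A B C w"
      using eq False w0 by (simp add: bary_def)
    have "(1 / mass v) *\<^sub>R v - (1 / mass w) *\<^sub>R w = 0"
      using c False w0 by (intro comb_eq_zero) (simp_all add: mass_diff comb_diff)
    then have "(mass v) *\<^sub>R (1 / mass v) *\<^sub>R v = mass v *\<^sub>R (1 / mass w) *\<^sub>R w"
      by simp
    then have "v = (mass v / mass w) *\<^sub>R w" using False by simp
    then show ?thesis by (metis cross_mult_left cross_refl scale_zero_right)
  qed
qed

lemma bary_surj:
  obtains v where "v \<noteq> 0" "X = bary A B C v"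
proof (cases X)
  case (Ordinary x)
  obtain v where "mass v = 1" "comb A B C v = x" using ex_comb by blast
  moreover from this have "v \<noteq> 0" by (auto simp: mass_def)
  ultimately show ?thesis using Ordinary that[of v] by (simp add: bary_def)
next
  case (Infinite d)
  obtain w where w: "w \<noteq> 0" "d = Abs_direction (span {w})" by (rule direction_cases)
  obtain v where "mass v = 0" "comb A B C v = w" using ex_comb by blast
  moreover from this w have "v \<noteq> 0" by (auto simp: comb_def)
  ultimately show ?thesis using Infinite w that[of v] by (simp add: bary_def)
qed

lemma bary_in_bline_iff:
  assumes "v \<noteq> 0"
  shows "bary A B C v \<in> bline A B C u \<longleftrightarrow> u \<bullet> v = 0"
proof
  assume "bary A B C v \<in> bline A B C u"
  then obtain w where w: "w \<noteq> 0" "u \<bullet> w = 0" "bary A B C v = bary A B C w"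
    by (auto simp: bline_def)
  then have "v \<times> w = 0" using bary_eq_iff assms by blast
  then show "u \<bullet> v = 0"
    using w(1,2) assms by (metis cross_zero_imp_scale inner_scaleR_right mult_zero_right)
qed (use assms in \<open>auto simp: bline_def\<close>)

lemma bline_scale: "k \<noteq> 0 \<Longrightarrow> bline A B C (k *\<^sub>R u) = bline A B C u"
  by (simp add: bline_def)

section \<open>Lines, joins and meets\<close>

text \<open>This is what makes lines, including the line at infinity, accessible to linear algebra: each of
  them consists of all points whose coordinates are orthogonal to one coefficient vector.\<close>

lemma line_imp_bline:
  assumes "is_line l"
  obtains u where "u \<noteq> 0" "l = bline A B C u"
proof -
  consider "l = line_at_infinity" | a d where "d \<noteq> 0" "l = ordinary_line a d"
    using assms unfolding is_line_def by blast
  then show ?thesis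
  proof cases
    case 1
    have "X \<in> line_at_infinity \<longleftrightarrow> X \<in> bline A B C (vector [1, 1, 1])" for X
    proof -
      obtain v where v: "v \<noteq> 0" "X = bary A B C v" by (rule bary_surj)
      have "X \<in> line_at_infinity \<longleftrightarrow> mass v = 0"
        by (auto simp: v line_at_infinity_def bary_def)
      also have "\<dots> \<longleftrightarrow> X \<in> bline A B C (vector [1, 1, 1])"
        using v by (simp add: bary_in_bline_iff mass_def inner_vec_def sum_3)
      finally show ?thesis .
    qed
    then show ?thesis
      using that[of "vector [1, 1, 1]"] 1 by (auto simp: eq_zero_3)
  next
    case 2
    obtain x where x: "mass x = 1" "comb A B C x = a" using ex_comb by blast
    obtain y where y: "mass y = 0" "comb A B C y = d" using ex_comb by blast
    have y0: "y \<noteq> 0" using y 2 by (auto simp: comb_def)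
    have x0: "x \<noteq> 0" using x by (auto simp: mass_def)
    have ind: "x \<times> y \<noteq> 0"
    proof
      assume "x \<times> y = 0"
      then obtain k where "x = k *\<^sub>R y" using cross_zero_imp_scale x0 y0 by blast
      then show False using x y by simp
    qed
    have "X \<in> ordinary_line a d \<longleftrightarrow> X \<in> bline A B C (x \<times> y)" for X
    proof -
      obtain v where v: "v \<noteq> 0" "X = bary A B C v" by (rule bary_surj)
      have "X \<in> ordinary_line a d \<longleftrightarrow> (X = bary A B C y \<or> (\<exists>t. X = bary A B C (x + t *\<^sub>R y)))"
        by (auto simp: ordinary_line_def bary_def x y mass_add comb_add)
      also have "\<dots> \<longleftrightarrow> (x \<times> y) \<bullet> v = 0"
      proof
        assume "X = bary A B C y \<or> (\<exists>t. X = bary A B C (x + t *\<^sub>R y))"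
        then have "\<exists>w. w \<noteq> 0 \<and> (x \<times> y) \<bullet> w = 0 \<and> X = bary A B C w"
        proof (elim disjE exE)
          fix t assume "X = bary A B C (x + t *\<^sub>R y)"
          moreover have "mass (x + t *\<^sub>R y) = 1"
            using x y by (simp add: mass_add)
          then have "x + t *\<^sub>R y \<noteq> 0" by (metis mass_zero zero_neq_one)
          ultimately show ?thesis
            by (intro exI[of _ "x + t *\<^sub>R y"]) (simp add: inner_add_right dot_cross_self)
        qed (use y0 in \<open>auto simp: dot_cross_self\<close>)
        then obtain w where w: "w \<noteq> 0" "(x \<times> y) \<bullet> w = 0" "X = bary A B C w"
          by blast
        then show "(x \<times> y) \<bullet> v = 0"
          using v bary_in_bline_iff by metis
      next
        assume *: "(x \<times> y) \<bullet> v = 0"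
        \<comment> \<open>The difference has mass \<open>0\<close> and lies on the line, so it represents the line's point at
            infinity \<open>y\<close>.\<close>
        have "\<exists>b. v - mass v *\<^sub>R x = b *\<^sub>R y"
        proof (cases "v - mass v *\<^sub>R x = 0")
          case True
          then show ?thesis by (metis scale_zero_left)
        next
          case False
          have mass_inner: "mass w = w \<bullet> vector [1, 1, 1]" for w
            by (simp add: mass_def inner_vec_def sum_3)
          have "vector [1, 1, 1] \<times> (x \<times> y) = - y"
            using x(1) y(1) by (simp add: Lagrange mass_inner inner_commute)
          moreover have "(v - mass v *\<^sub>R x) \<bullet> vector [1, 1, 1] = 0"
            using x(1) by (simp add: mass_diff flip: mass_inner)
          moreover have "(x \<times> y) \<bullet> (v - mass v *\<^sub>R x) = 0"
            using * by (simp add: inner_diff_right dot_cross_self)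
          then have "(v - mass v *\<^sub>R x) \<bullet> (x \<times> y) = 0"
            by (simp only: inner_commute)
          ultimately obtain k where "v - mass v *\<^sub>R x = k *\<^sub>R (- y)"
            using orthogonal_imp_parallel_cross[OF _ _ False] y0 by (metis neg_equal_0_iff_equal)
          then show ?thesis by (metis scaleR_minus_left scaleR_minus_right)
        qed
        then have "\<exists>a b. v = a *\<^sub>R x + b *\<^sub>R y"
          by (metis add.commute diff_add_cancel)
        then obtain a b where ab: "v = a *\<^sub>R x + b *\<^sub>R y" by blast
        show "X = bary A B C y \<or> (\<exists>t. X = bary A B C (x + t *\<^sub>R y))"
        proof (cases "a = 0")
          case True
          then show ?thesis using v ab y0 bary_scale by auto
        next
          case False
          then have "v = a *\<^sub>R (x + (b / a) *\<^sub>R y)" by (simp add: ab algebra_simps)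
          then have "X = bary A B C (x + (b / a) *\<^sub>R y)"
            using v False bary_scale by (metis scale_zero_right)
          then show ?thesis by blast
        qed
      qed
      also have "\<dots> \<longleftrightarrow> X \<in> bline A B C (x \<times> y)"
        using v bary_in_bline_iff by simp
      finally show ?thesis .
    qed
    then show ?thesis using that[OF ind] 2 by blast
  qed
qed

lemma distinct_points_on_line:
  assumes "X \<noteq> Y"
  obtains l where "is_line l" "X \<in> l" "Y \<in> l"
proof -
  have ord_inf: "\<exists>l. is_line l \<and> Ordinary x \<in> l \<and> Infinite e \<in> l" for x e
  proof -
    obtain d where d: "d \<noteq> 0" "e = Abs_direction (span {d})" by (rule direction_cases)
    then have "is_line (ordinary_line x d)" "Infinite e \<in> ordinary_line x d"
      unfolding is_line_def by blast (simp add: d ordinary_line_def)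
    moreover have "Ordinary x \<in> ordinary_line x d"
      by (auto simp: ordinary_line_def intro: range_eqI[of _ _ 0])
    ultimately show ?thesis by blast
  qed
  show ?thesis
  proof (cases X; cases Y)
    fix x y assume XY: "X = Ordinary x" "Y = Ordinary y"
    have "is_line (ordinary_line x (y - x))"
      using XY assms unfolding is_line_def by (intro disjI2 exI[of _ x] exI[of _ "y - x"]) simp
    moreover have "Ordinary x \<in> ordinary_line x (y - x)"
      by (auto simp: ordinary_line_def intro: range_eqI[of _ _ 0])
    moreover have "Ordinary y \<in> ordinary_line x (y - x)"
      by (auto simp: ordinary_line_def intro: range_eqI[of _ _ 1])
    ultimately show thesis using that XY by blast
  next
    fix x y assume "X = Infinite x" "Y = Infinite y"
    then show thesis using that[of line_at_infinity] by (auto simp: is_line_def line_at_infinity_def)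
  qed (use ord_inf that in blast)+
qed

text \<open>A coefficient vector orthogonal to both \<open>x\<close> and \<open>y\<close> is a multiple of their cross product.\<close>

lemma line_eq_bline_cross:
  assumes "is_line l" "bary A B C x \<in> l" "bary A B C y \<in> l" "x \<times> y \<noteq> 0"
  shows "l = bline A B C (x \<times> y)"
proof -
  have xy: "x \<noteq> 0" "y \<noteq> 0" using assms by auto
  obtain u where u: "u \<noteq> 0" "l = bline A B C u" using assms(1) by (rule line_imp_bline)
  then have "u \<bullet> x = 0" "u \<bullet> y = 0" using assms xy bary_in_bline_iff by auto
  then obtain k where "k \<noteq> 0" "u = k *\<^sub>R (x \<times> y)"
    using orthogonal_imp_parallel_cross u assms by metis
  then show ?thesis using u bline_scale by simp
qed

lemma join_bary:
  assumes "x \<times> y \<noteq> 0"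
  shows "is_line (bline A B C (x \<times> y))"
    and "join (bary A B C x) (bary A B C y) = bline A B C (x \<times> y)"
proof -
  have xy: "x \<noteq> 0" "y \<noteq> 0" using assms by auto
  then have "bary A B C x \<noteq> bary A B C y" using assms bary_eq_iff by blast
  then obtain l where l: "is_line l" "bary A B C x \<in> l" "bary A B C y \<in> l"
    by (rule distinct_points_on_line)
  then have eq: "l = bline A B C (x \<times> y)" using line_eq_bline_cross assms by blast
  then show "is_line (bline A B C (x \<times> y))" using l by blast
  show "join (bary A B C x) (bary A B C y) = bline A B C (x \<times> y)"
    unfolding join_def
    by (rule the_equality) (use l eq line_eq_bline_cross assms in blast)+
qed

lemma meet_bline:
  assumes "u \<times> w \<noteq> 0"
  shows "meet (bline A B C u) (bline A B C w) = bary A B C (u \<times> w)"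
  unfolding meet_def
proof (rule the_equality)
  show "bary A B C (u \<times> w) \<in> bline A B C u \<and> bary A B C (u \<times> w) \<in> bline A B C w"
    using assms by (simp add: bary_in_bline_iff dot_cross_self)
next
  fix X assume X: "X \<in> bline A B C u \<and> X \<in> bline A B C w"
  obtain v where v: "v \<noteq> 0" "X = bary A B C v" by (rule bary_surj)
  then have "v \<bullet> u = 0" "v \<bullet> w = 0" using X bary_in_bline_iff by (auto simp: inner_commute)
  then obtain k where "k \<noteq> 0" "v = k *\<^sub>R (u \<times> w)"
    using orthogonal_imp_parallel_cross v assms by metis
  then show "X = bary A B C (u \<times> w)" using v bary_scale assms by simp
qed


text \<open>A vector of mass \<open>0\<close> on an ordinary line represents the line's only point at infinity, and so it
  spans the direction of the line. The point \<open>x\<close> serves to exclude the line at infinity.\<close>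

lemma along_bline:
  assumes line: "is_line (bline A B C u)"
    and x: "u \<bullet> x = 0" "mass x \<noteq> 0" and w: "u \<bullet> w = 0" "mass w = 0"
  shows "along (comb A B C w) (bline A B C u)"
proof -
  have x0: "x \<noteq> 0" using x by (auto simp: mass_def)
  then have "bary A B C x \<in> bline A B C u" using x bary_in_bline_iff by blast
  then have "bline A B C u \<noteq> line_at_infinity"
    using x by (auto simp: bary_def line_at_infinity_def)
  then obtain a d where d: "d \<noteq> 0" "bline A B C u = ordinary_line a d"
    using line unfolding is_line_def by blast
  have "comb A B C w \<in> span {d}"
  proof (cases "w = 0")
    case True
    then show ?thesis by (simp add: comb_def span_zero)
  next
    case False
    then have "bary A B C w \<in> ordinary_line a d" using w bary_in_bline_iff d by auto
    moreover have c0: "comb A B C w \<noteq> 0" using False w comb_eq_zero by blast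
    ultimately have "Abs_direction (span {comb A B C w}) = Abs_direction (span {d})"
      using w by (auto simp: bary_def ordinary_line_def)
    then obtain k where "comb A B C w = k *\<^sub>R d"
      using direction_span_eq_iff[OF c0 d(1)] by blast
    then show ?thesis
      by (simp add: span_base span_scale)
  qed
  then show ?thesis using d unfolding along_def by blast
qed

text \<open>Statements about one vertex are carried over to the other two by cyclic permutation.\<close>

lemma rotate: "triangle B C A" "triangle C A B"
  using noncollinear by unfold_locales (simp_all add: insert_commute)

end

lemma bary_rotate:
  "bary B C A (vector [y, z, x]) = bary A B C (vector [x, y, z])"
  "bary C A B (vector [z, x, y]) = bary A B C (vector [x, y, z])"
  by (simp_all add: bary_def comb_def mass_def add_ac)

section \<open>Traces and affine maps\<close>

lemma cross_vector:
  "vector [a, b, c] \<times> vector [x, y, z] = vector [b * z - c * y, c * x - a * z, a * y - b * x]"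
  by (simp add: cross3_def)

lemma inner_vector3: "(vector [a, b, c] :: real^3) \<bullet> vector [x, y, z] = a * x + b * y + c * z"
  by (simp add: inner_vec_def sum_3)

lemma scale_vector3: "k *\<^sub>R (vector [x, y, z] :: real^3) = vector [k * x, k * y, k * z]"
  by (simp add: vec_eq_iff forall_3)

lemma vector3_eta: "(v :: real^3) = vector [v$1, v$2, v$3]"
  by (simp add: vec_eq_iff forall_3)

context triangle begin

lemma vertex_bary:
  "Ordinary A = bary A B C (vector [1, 0, 0])"
  "Ordinary B = bary A B C (vector [0, 1, 0])"
  "Ordinary C = bary A B C (vector [0, 0, 1])"
  by (simp_all add: bary_def comb_def mass_def)

lemma bary_scale_vector:
  "k \<noteq> 0 \<Longrightarrow> (x, y, z) \<noteq> (0, 0, 0) \<Longrightarrow>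
     bary A B C (vector [k * x, k * y, k * z]) = bary A B C (vector [x, y, z])"
  using bary_scale[of k "vector [x, y, z]"] by (simp add: scale_vector3 eq_zero_3)

lemma trace_bary:
  assumes "(y, z) \<noteq> (0, 0)"
  shows "trace_point A B C (bary A B C (vector [x, y, z])) = bary A B C (vector [0, y, z])"
proof -
  have "join (Ordinary A) (bary A B C (vector [x, y, z])) = bline A B C (vector [0, - z, y])"
    using join_bary(2)[of "vector [1, 0, 0]" "vector [x, y, z]"] assms
    by (auto simp: cross_vector eq_zero_3 vertex_bary)
  moreover have "join (Ordinary B) (Ordinary C) = bline A B C (vector [1, 0, 0])"
    using join_bary(2)[of "vector [0, 1, 0]" "vector [0, 0, 1]"]
    by (simp add: cross_vector eq_zero_3 vertex_bary)
  ultimately show ?thesis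
    using meet_bline[of "vector [0, - z, y]" "vector [1, 0, 0]"] assms
    unfolding trace_point_def by (auto simp: cross_vector eq_zero_3)
qed

lemma reflect_trace_bary:
  assumes "y + z \<noteq> 0"
  shows "reflected_trace A B C (bary A B C (vector [x, y, z])) = bary A B C (vector [0, z, y])"
proof -
  have "2 *\<^sub>R midpoint B C - (1 / (y + z)) *\<^sub>R (y *\<^sub>R B + z *\<^sub>R C)
      = (1 / (y + z)) *\<^sub>R ((y + z) *\<^sub>R (B + C) - (y *\<^sub>R B + z *\<^sub>R C))"
    using assms by (simp add: midpoint_def scaleR_diff_right)
  also have "\<dots> = (1 / (y + z)) *\<^sub>R (z *\<^sub>R B + y *\<^sub>R C)"
    by (simp add: algebra_simps)
  finally have "2 *\<^sub>R midpoint B C - (1 / (y + z)) *\<^sub>R (y *\<^sub>R B + z *\<^sub>R C)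
      = (1 / (y + z)) *\<^sub>R (z *\<^sub>R B + y *\<^sub>R C)" .
  moreover have "trace_point A B C (bary A B C (vector [x, y, z])) = bary A B C (vector [0, y, z])"
    using assms by (intro trace_bary) auto
  ultimately show ?thesis
    using assms
    by (simp add: reflected_trace_def bary_def mass_def comb_def add.commute[of z y])
qed

text \<open>An affine map with prescribed values at the vertices exists because the edge vectors at \<open>B\<close> are
  linearly independent, and it is unique because affine maps preserve weighted means.\<close>

lemma affine_map_of_works:
  fixes X Y Z :: "real^2"
  defines "f \<equiv> affine_map_of A B C (Ordinary X) (Ordinary Y) (Ordinary Z)"
  shows "affine_map f" "f A = X" "f B = Y" "f C = Z"
proof -
  let ?L = "\<lambda>y :: real^2. y$1 *\<^sub>R (A - B) + y$2 *\<^sub>R (C - B)"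
  let ?M = "\<lambda>y :: real^2. y$1 *\<^sub>R (X - Y) + y$2 *\<^sub>R (Z - Y)"
  obtain g where g: "linear g" "g \<circ> ?L = id"
    using linear_injective_left_inverse edge_vectors_linear_inj by blast
  let ?h = "\<lambda>x. (?M \<circ> g) x + (Y - (?M \<circ> g) B)"
  have "linear ?M" by (intro linearI) (simp_all add: algebra_simps)
  then have "linear (?M \<circ> g)" using g(1) by (intro linear_compose)
  then have "affine_map ?h" unfolding affine_map_def by blast
  moreover have "g (A - B) = vector [1, 0]" "g (C - B) = vector [0, 1]"
    using fun_cong[OF g(2), of "vector [1, 0]"] fun_cong[OF g(2), of "vector [0, 1]"] by simp_all
  then have "g A = g B + vector [1, 0]" "g C = g B + vector [0, 1]"
    using g(1) by (simp_all add: linear_diff algebra_simps)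
  then have "?h A = X" "?h B = Y" "?h C = Z"
    by (simp_all add: algebra_simps)
  moreover have "f1 = f2"
    if "affine_map f1 \<and> f1 A = X \<and> f1 B = Y \<and> f1 C = Z"
      "affine_map f2 \<and> f2 A = X \<and> f2 B = Y \<and> f2 C = Z"
    for f1 f2
  proof
    fix x
    obtain v where "mass v = 1" "comb A B C v = x" using ex_comb by blast
    then show "f1 x = f2 x"
      using affine_map_comb[of f1 v A B C] affine_map_comb[of f2 v A B C] that by auto
  qed
  ultimately have "\<exists>!f. affine_map f \<and> f A = X \<and> f B = Y \<and> f C = Z"
    by blast
  then have "affine_map f \<and> f A = X \<and> f B = Y \<and> f C = Z"
    unfolding f_def affine_map_of_def ext_point.inject by (rule theI')
  then show "affine_map f" "f A = X" "f B = Y" "f C = Z" by auto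
qed

end

section \<open>The cevian maps in coordinates\<close>

text \<open>The map \<open>cev p q r\<close> is the matrix whose columns are the traces \<open>D, E, F\<close> of \<open>(p : q : r)\<close>,
  normalised to mass \<open>1\<close>; \<open>cev' p q r\<close> has the columns \<open>D\<^sub>3, E\<^sub>3, F\<^sub>3\<close>.\<close>

definition cev :: "real \<Rightarrow> real \<Rightarrow> real \<Rightarrow> real^3 \<Rightarrow> real^3" where
  "cev p q r v = vector
     [p * (v$2 / (r + p) + v$3 / (p + q)),
      q * (v$3 / (p + q) + v$1 / (q + r)),
      r * (v$1 / (q + r) + v$2 / (r + p))]"

definition cev' :: "real \<Rightarrow> real \<Rightarrow> real \<Rightarrow> real^3 \<Rightarrow> real^3" where
  "cev' p q r v = vector
     [r * v$2 / (r + p) + q * v$3 / (p + q),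
      p * v$3 / (p + q) + r * v$1 / (q + r),
      q * v$1 / (q + r) + p * v$2 / (r + p)]"

text \<open>The coordinates of the translation vector of the commutator, written as the combination of
  \<open>(p, q, r)\<close> and \<open>(qr, rp, pq)\<close> that has mass \<open>0\<close>. For \<open>P \<noteq> P'\<close> this makes it either zero or a
  coordinate vector of the point at infinity of the line \<open>PP'\<close>.\<close>

definition shift :: "real \<Rightarrow> real \<Rightarrow> real \<Rightarrow> real^3" where
  "shift p q r = (1 / ((p + q) * (q + r) * (r + p))) *\<^sub>R
     ((p + q + r) *\<^sub>R vector [q * r, r * p, p * q] - (q * r + r * p + p * q) *\<^sub>R vector [p, q, r])"

locale cevian_sums =
  fixes p q r :: real
  assumes nz: "p \<noteq> 0" "q \<noteq> 0" "r \<noteq> 0" "q + r \<noteq> 0" "r + p \<noteq> 0" "p + q \<noteq> 0"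
begin

lemma cev_scale: "cev p q r (k *\<^sub>R v) = k *\<^sub>R cev p q r v"
  by (simp add: cev_def vec_eq_iff forall_3 algebra_simps)

text \<open>Reflecting a trace in the midpoint of its side swaps its two coordinates. On \<open>BC\<close>, this
  turns \<open>(0 : q : r)\<close> into \<open>(0 : r : q) = (0 : rp : pq)\<close>, the trace of \<open>(qr : rp : pq)\<close>.\<close>

lemma cev'_eq: "cev (q * r) (r * p) (p * q) v = cev' p q r v"
proof -
  have sums: "r * p + p * q = p * (q + r)" "p * q + q * r = q * (r + p)" "q * r + r * p = r * (p + q)"
    by (simp_all add: algebra_simps)
  have cancel: "(b * a) * (x / (b * c) + y / (a * d)) = a * x / c + b * y / d"
    if "a \<noteq> 0" "b \<noteq> 0" for a b c d x y :: real
    using that by (simp add: distrib_left)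
  show ?thesis
    unfolding cev_def cev'_def sums by (simp only: cancel[OF nz(3,2)] cancel[OF nz(1,3)] cancel[OF nz(2,1)])
qed

text \<open>The columns have mass \<open>1\<close>.\<close>

lemma mass_cev: "mass (cev p q r v) = mass v"
  using nz by ((simp add: mass_def cev_def), (simp add: divide_simps), algebra)

lemma mass_shift: "mass (shift p q r) = 0"
  by (simp add: shift_def mass_diff) (simp add: mass_def)

lemma reciprocals:
  obtains a b c where "a * (q + r) = 1" "b * (r + p) = 1" "c * (p + q) = 1"
    "\<And>x. x / (q + r) = x * a" "\<And>x. x / (r + p) = x * b" "\<And>x. x / (p + q) = x * c"
  by (rule that[of "1 / (q + r)" "1 / (r + p)" "1 / (p + q)"]) (use nz in auto)

lemma shift_components:
  "shift p q r = vector
     [(q * r - p\<^sup>2) / (p + q) / (r + p),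
      (r * p - q\<^sup>2) / (q + r) / (p + q),
      (p * q - r\<^sup>2) / (r + p) / (q + r)]"
proof -
  obtain a b c where abc: "a * (q + r) = 1" "b * (r + p) = 1" "c * (p + q) = 1"
    and div: "\<And>x. x / (q + r) = x * a" "\<And>x. x / (r + p) = x * b" "\<And>x. x / (p + q) = x * c"
    using reciprocals by blast
  have N: "1 / ((p + q) * (q + r) * (r + p)) = c * a * b"
    unfolding divide_divide_eq_left[symmetric] div by simp
  show ?thesis
    unfolding shift_def N div vec_eq_iff forall_3 using abc
    by (simp, intro conjI; algebra)
qed

text \<open>All of these are polynomial identities in \<open>p, q, r\<close> and the reciprocals of \<open>q + r\<close>, \<open>r + p\<close>,
  \<open>p + q\<close>. In \<open>commutator\<close>, the factor \<open>mass v\<close> says that the two products differ by a translation: they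
  agree on vectors, and on points they differ by \<open>shift p q r\<close>.\<close>

lemma commutator:
    "cev' p q r (cev p q r v) = cev p q r (cev' p q r v) + mass v *\<^sub>R shift p q r"
  and cev_isotomic_conjugate:
    "cev p q r (vector [q * r, r * p, p * q]) =
       vector [q * r, r * p, p * q] - (q * r + r * p + p * q) *\<^sub>R shift p q r"
  and cev'_self:
    "cev' p q r (vector [p, q, r]) = vector [p, q, r] + (p + q + r) *\<^sub>R shift p q r"
  and cev_centroid:
    "cev p q r (vector [1, 1, 1]) = vector [1, 1, 1] - shift p q r"
proof -
  obtain a b c where abc: "a * (q + r) = 1" "b * (r + p) = 1" "c * (p + q) = 1"
    and div: "\<And>x. x / (q + r) = x * a" "\<And>x. x / (r + p) = x * b" "\<And>x. x / (p + q) = x * c"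
    using reciprocals by blast
  note defs = shift_components cev_def cev'_def mass_def div vec_eq_iff forall_3
  show "cev' p q r (cev p q r v) = cev p q r (cev' p q r v) + mass v *\<^sub>R shift p q r"
    unfolding defs using abc by (simp, intro conjI; algebra)
  show "cev p q r (vector [q * r, r * p, p * q]) =
      vector [q * r, r * p, p * q] - (q * r + r * p + p * q) *\<^sub>R shift p q r"
    unfolding defs using abc by (simp, intro conjI; algebra)
  show "cev' p q r (vector [p, q, r]) = vector [p, q, r] + (p + q + r) *\<^sub>R shift p q r"
    unfolding defs using abc by (simp, intro conjI; algebra)
  show "cev p q r (vector [1, 1, 1]) = vector [1, 1, 1] - shift p q r"
    unfolding defs using abc by (simp, intro conjI; algebra)
qed

text \<open>The matrix is a product of the diagonal matrices of \<open>(p, q, r)\<close> and of the reciprocals of the sums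
  with the matrix of \<open>(x, y, z) \<mapsto> (y + z, z + x, x + y)\<close>, all three invertible.\<close>

lemma cev_surj:
  obtains u where "cev p q r u = v"
proof -
  have lin: "linear (cev p q r)"
    by (intro linearI) (simp_all add: cev_def vec_eq_iff forall_3 algebra_simps add_divide_distrib)
  have "v = 0" if "cev p q r v = 0" for v
  proof -
    have "v$2 / (r + p) + v$3 / (p + q) = 0" "v$3 / (p + q) + v$1 / (q + r) = 0"
      "v$1 / (q + r) + v$2 / (r + p) = 0"
      using that nz by (simp_all add: cev_def eq_zero_3)
    then have "v$1 / (q + r) = 0" "v$2 / (r + p) = 0" "v$3 / (p + q) = 0"
      by linarith+
    then show ?thesis using nz by (simp add: eq_zero_3)
  qed
  then have "surj (cev p q r)"
    using lin linear_injective_0 linear_injective_imp_surjective by blast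
  then show ?thesis using that by (metis surjD)
qed

lemma conjugate: "cevian_sums (q * r) (r * p) (p * q)"
proof
  have "r * p + p * q = p * (q + r)" "p * q + q * r = q * (r + p)" "q * r + r * p = r * (p + q)"
    by (simp_all add: algebra_simps)
  then show "r * p + p * q \<noteq> 0" "p * q + q * r \<noteq> 0" "q * r + r * p \<noteq> 0"
    using nz by auto
qed (use nz in auto)

end

section \<open>The commutator of the two cevian maps\<close>

locale triangle_cevian = triangle A B C + cevian_sums p q r for A B C p q r
begin

abbreviation "P \<equiv> bary A B C (vector [p, q, r])"
abbreviation "P' \<equiv> bary A B C (vector [q * r, r * p, p * q])"

lemma traces:
  "trace_point A B C P = bary A B C (vector [0, q, r])"
  "trace_point B C A P = bary A B C (vector [p, 0, r])"
  "trace_point C A B P = bary A B C (vector [p, q, 0])"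
  using trace_bary[of q r p] triangle.trace_bary[OF rotate(1), of r p q]
    triangle.trace_bary[OF rotate(2), of p q r] nz
  by (auto simp: bary_rotate)

lemma reflected_traces:
  "reflected_trace A B C P = bary A B C (vector [0, r, q])"
  "reflected_trace B C A P = bary A B C (vector [r, 0, p])"
  "reflected_trace C A B P = bary A B C (vector [q, p, 0])"
  using reflect_trace_bary[of q r p] triangle.reflect_trace_bary[OF rotate(1), of r p q]
    triangle.reflect_trace_bary[OF rotate(2), of p q r] nz
  by (auto simp: bary_rotate)

lemma reflected_cevian_map_eq:
  "reflected_cevian_map A B C P = cevian_map A B C P'"
proof -
  interpret conj: triangle_cevian A B C "q * r" "r * p" "p * q"
    using triangle_axioms conjugate by (simp add: triangle_cevian_def)
  show ?thesis
    unfolding reflected_cevian_map_def cevian_map_def reflected_traces conj.traces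
    using bary_scale_vector[of p 0 r q] bary_scale_vector[of q r 0 p] bary_scale_vector[of r q p 0] nz
    by (simp add: mult.commute)
qed

text \<open>The line \<open>AD\<^sub>3\<close> is \<open>q y = r z\<close> in coordinates \<open>(x : y : z)\<close>, and cyclically for the other two; the only
  common solution of the three equations is \<open>(qr : rp : pq)\<close>.\<close>

lemma isotomic_conjugate_eq: "isotomic_conjugate A B C P = P'"
proof -
  have j: "join (Ordinary A) (reflected_trace A B C P) = bline A B C (vector [0, - q, r])"
    "join (Ordinary B) (reflected_trace B C A P) = bline A B C (vector [p, 0, - r])"
    "join (Ordinary C) (reflected_trace C A B P) = bline A B C (vector [- p, q, 0])"
    unfolding reflected_traces
    using join_bary(2)[of "vector [1, 0, 0]" "vector [0, r, q]"]
      join_bary(2)[of "vector [0, 1, 0]" "vector [r, 0, p]"]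
      join_bary(2)[of "vector [0, 0, 1]" "vector [q, p, 0]"] nz
    by (auto simp: cross_vector eq_zero_3 vertex_bary)
  have P'0: "vector [q * r, r * p, p * q] \<noteq> (0 :: real^3)"
    using nz by (simp add: eq_zero_3)
  show ?thesis
    unfolding isotomic_conjugate_def j
  proof (rule the_equality)
    show "P' \<in> bline A B C (vector [0, - q, r]) \<and> P' \<in> bline A B C (vector [p, 0, - r])
        \<and> P' \<in> bline A B C (vector [- p, q, 0])"
      by (simp add: bary_in_bline_iff[OF P'0] inner_vector3)
  next
    fix X
    assume X: "X \<in> bline A B C (vector [0, - q, r]) \<and> X \<in> bline A B C (vector [p, 0, - r])
        \<and> X \<in> bline A B C (vector [- p, q, 0])"
    obtain v where v: "v \<noteq> 0" "X = bary A B C v" by (rule bary_surj)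
    have "vector [0, - q, r] \<bullet> v = 0" "vector [p, 0, - r] \<bullet> v = 0" "vector [- p, q, 0] \<bullet> v = 0"
      using X bary_in_bline_iff[OF v(1)] v(2) by blast+
    then have "q * v$2 = r * v$3" "p * v$1 = r * v$3" "p * v$1 = q * v$2"
      by (simp_all add: inner_vec_def sum_3)
    then have "v \<times> vector [q * r, r * p, p * q] = 0"
      unfolding cross3_def eq_zero_3 vector_3 by (intro conjI; algebra)
    then show "X = P'" using v P'0 bary_eq_iff by blast
  qed
qed

lemma cevian_map:
  shows "affine_map (cevian_map A B C P)"
    and "mass v = 1 \<Longrightarrow> cevian_map A B C P (comb A B C v) = comb A B C (cev p q r v)"
proof -
  have eq: "cevian_map A B C P = affine_map_of A B C
      (Ordinary (comb A B C (vector [0, q / (q + r), r / (q + r)])))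
      (Ordinary (comb A B C (vector [p / (r + p), 0, r / (r + p)])))
      (Ordinary (comb A B C (vector [p / (p + q), q / (p + q), 0])))"
    using nz unfolding cevian_map_def traces
    by (simp add: bary_def mass_def comb_def scaleR_add_right add.commute[of p r])
  show aff: "affine_map (cevian_map A B C P)"
    unfolding eq by (rule affine_map_of_works)
  show "cevian_map A B C P (comb A B C v) = comb A B C (cev p q r v)" if "mass v = 1"
    unfolding affine_map_comb[OF aff that]
    unfolding eq affine_map_of_works
    by (simp add: comb_def cev_def algebra_simps)
qed

lemma surj_cevian_map: "surj (cevian_map A B C P)"
proof -
  have "\<exists>x. cevian_map A B C P x = y" for y
  proof -
    obtain v where v: "mass v = 1" "comb A B C v = y" using ex_comb by blast
    obtain u where "cev p q r u = v" by (rule cev_surj)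
    then show ?thesis using cevian_map(2)[of u] v mass_cev by metis
  qed
  then show ?thesis by (metis surj_def)
qed

lemma conjugate_triangle: "triangle_cevian A B C (q * r) (r * p) (p * q)"
  using triangle_axioms conjugate by (simp add: triangle_cevian_def)

lemma reflected_cevian_map:
  assumes "mass v = 1"
  shows "reflected_cevian_map A B C P (comb A B C v) = comb A B C (cev' p q r v)"
  using triangle_cevian.cevian_map(2)[OF conjugate_triangle assms]
  by (simp add: reflected_cevian_map_eq cev'_eq)

lemma surj_reflected_cevian_map: "surj (reflected_cevian_map A B C P)"
  using triangle_cevian.surj_cevian_map[OF conjugate_triangle]
  by (simp add: reflected_cevian_map_eq)

lemma maps_commute_up_to_shift:
  "reflected_cevian_map A B C P (cevian_map A B C P x) =
   cevian_map A B C P (reflected_cevian_map A B C P x) + comb A B C (shift p q r)"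
proof -
  obtain v where v: "mass v = 1" "comb A B C v = x" using ex_comb by blast
  then have "mass (cev p q r v) = 1" "mass (cev' p q r v) = 1"
    using mass_cev[of v] cevian_sums.mass_cev[OF conjugate, of v] by (simp_all add: cev'_eq)
  then show ?thesis
    using v(1) unfolding v(2)[symmetric]
    by (simp add: cevian_map(2) reflected_cevian_map commutator comb_add)
qed

text \<open>Every point is \<open>T\<^sub>P (T\<^sub>P\<^sub>' X)\<close> for some \<open>X\<close>, and the commutator sends it to \<open>T\<^sub>P\<^sub>' (T\<^sub>P X)\<close>.\<close>

lemma commutator_translation:
  "reflected_cevian_map A B C P \<circ> cevian_map A B C P
     \<circ> inv (reflected_cevian_map A B C P) \<circ> inv (cevian_map A B C P)
   = (\<lambda>x. x + comb A B C (shift p q r))"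
  using maps_commute_up_to_shift surj_f_inv_f[OF surj_cevian_map]
    surj_f_inv_f[OF surj_reflected_cevian_map]
  by (simp add: fun_eq_iff)

lemma P_eq_P'_iff: "P = P' \<longleftrightarrow> vector [p, q, r] \<times> vector [q * r, r * p, p * q] = 0"
  by (rule bary_eq_iff) (use nz in \<open>simp_all add: eq_zero_3\<close>)

text \<open>If \<open>P = P'\<close>, the coordinates of \<open>P\<close> have equal squares; opposite signs are excluded because the
  sums are nonzero. So only the centroid is its own isotomic conjugate here.\<close>

lemma P_eq_P'_imp_equal: "P = P' \<Longrightarrow> p = q \<and> q = r"
proof -
  assume "P = P'"
  then have eq: "q * (p * q) - r * (r * p) = 0" "p * (r * p) - q * (q * r) = 0"
    unfolding P_eq_P'_iff cross_vector eq_zero_3 vector_3 by blast+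
  have "p * ((q - r) * (q + r)) = 0" "r * ((p - q) * (p + q)) = 0"
    using eq by algebra+
  then show ?thesis using nz by simp
qed

lemma shift_along_PP':
  assumes "P \<noteq> P'"
  shows "along (comb A B C (shift p q r)) (join P P')"
proof -
  let ?x = "vector [p, q, r] :: real^3" and ?y = "vector [q * r, r * p, p * q] :: real^3"
  have ind: "?x \<times> ?y \<noteq> 0" using assms P_eq_P'_iff by blast
  \<comment> \<open>\<open>P\<close> and \<open>P'\<close> are not both infinite, because \<open>p + q + r = 0 = qr + rp + pq\<close> would make the sum
      of squares vanish. Hence the line \<open>PP'\<close> is ordinary.\<close>
  have "mass ?x \<noteq> 0 \<or> mass ?y \<noteq> 0"
  proof (rule ccontr)
    assume "\<not> ?thesis"
    then have "p + q + r = 0" "q * r + r * p + p * q = 0" by (simp_all add: mass_def)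
    moreover have "(p + q + r)\<^sup>2 = p\<^sup>2 + q\<^sup>2 + r\<^sup>2 + 2 * (q * r + r * p + p * q)"
      by (simp add: power2_eq_square algebra_simps)
    ultimately have "p\<^sup>2 + q\<^sup>2 + r\<^sup>2 = 0" by simp
    moreover have "p\<^sup>2 > 0" using nz(1) by simp
    ultimately show False
      using zero_le_power2[of q] zero_le_power2[of r] by linarith
  qed
  then obtain x where x: "(?x \<times> ?y) \<bullet> x = 0" "mass x \<noteq> 0"
    by (elim disjE) (erule that[rotated], rule dot_cross_self)+
  have "(?x \<times> ?y) \<bullet> shift p q r = 0"
    by (simp add: shift_def inner_diff_right dot_cross_self)
  then show ?thesis
    using along_bline[OF join_bary(1)[OF ind] x _ mass_shift] join_bary(2)[OF ind] by simp
qed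

lemma cevian_map_isotomic_conjugate:
  assumes "q * r + r * p + p * q \<noteq> 0" and "P' = Ordinary x"
  shows "cevian_map A B C P x = x - comb A B C (shift p q r)"
proof -
  let ?t = "q * r + r * p + p * q" and ?y = "vector [q * r, r * p, p * q] :: real^3"
  have x: "x = comb A B C ((1 / ?t) *\<^sub>R ?y)"
    using assms by (simp add: bary_def mass_def)
  have "mass ?y = ?t"
    by (simp add: mass_def)
  then have "mass ((1 / ?t) *\<^sub>R ?y) = 1"
    using assms(1) by simp
  from cevian_map(2)[OF this]
  show ?thesis
    using assms(1) unfolding x
    by (simp only: cev_scale cev_isotomic_conjugate comb_scale comb_diff) (simp add: scaleR_diff_right)
qed

lemma reflected_cevian_map_self:
  assumes "p + q + r \<noteq> 0" and "P = Ordinary x"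
  shows "reflected_cevian_map A B C P x = x + comb A B C (shift p q r)"
proof -
  let ?s = "p + q + r" and ?y = "vector [p, q, r] :: real^3"
  have x: "x = comb A B C ((1 / ?s) *\<^sub>R ?y)"
    using assms by (simp add: bary_def mass_def)
  have "mass ?y = ?s"
    by (simp add: mass_def)
  then have "mass ((1 / ?s) *\<^sub>R ?y) = 1"
    using assms(1) by simp
  from reflected_cevian_map[OF this]
  show ?thesis
    using assms(1) unfolding x
    by (simp only: cevian_sums.cev_scale[OF conjugate, unfolded cev'_eq] cev'_self comb_scale comb_add)
      (simp add: scaleR_add_right)
qed

lemma cevian_map_centroid:
  "cevian_map A B C P (centroid A B C) = centroid A B C - (1/3) *\<^sub>R comb A B C (shift p q r)"
proof -
  let ?g = "(1/3) *\<^sub>R vector [1, 1, 1] :: real^3"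
  have g: "centroid A B C = comb A B C ?g"
    by (simp add: centroid_def comb_def scaleR_add_right)
  have "mass ?g = 1"
    by (simp add: mass_def)
  from cevian_map(2)[OF this]
  show ?thesis unfolding g
    by (simp only: cev_scale cev_centroid comb_scale comb_diff scaleR_diff_right)
qed

end

section \<open>The excluded lines and the theorem\<close>

context triangle begin

lemma side_bary:
  "bary A B C v \<in> join (Ordinary B) (Ordinary C) \<longleftrightarrow> v$1 = 0"
  if "v \<noteq> 0" for v
proof -
  have "join (Ordinary B) (Ordinary C) = bline A B C (vector [1, 0, 0])"
    using join_bary(2)[of "vector [0, 1, 0]" "vector [0, 0, 1]"]
    by (simp add: cross_vector eq_zero_3 vertex_bary)
  then show ?thesis using that by (simp add: bary_in_bline_iff inner_vec_def sum_3)
qed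

lemma anticomplement_eq:
  "anticomplement A B C A = B + C - A"
  "anticomplement A B C B = C + A - B"
  "anticomplement A B C C = A + B - C"
proof -
  have "inj (homothety (centroid A B C) (-1/2))"
    by (auto simp: inj_def homothety_def)
  then have inv: "anticomplement A B C (homothety (centroid A B C) (-1/2) x) = x" for x
    unfolding anticomplement_def by (rule inv_f_f)
  have "homothety (centroid A B C) (-1/2) (B + C - A) = A"
    "homothety (centroid A B C) (-1/2) (C + A - B) = B"
    "homothety (centroid A B C) (-1/2) (A + B - C) = C"
    by (simp_all add: homothety_def centroid_def vec_eq_iff field_simps)
  with inv show "anticomplement A B C A = B + C - A"
    "anticomplement A B C B = C + A - B"
    "anticomplement A B C C = A + B - C"
    by metis+
qed

text \<open>The side of the anticomplementary triangle through \<open>A\<close> is the parallel to \<open>BC\<close>, that is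
  \<open>y + z = 0\<close>.\<close>

lemma anticomplementary_side_bary:
  "bary A B C v \<in> join (Ordinary (C + A - B)) (Ordinary (A + B - C)) \<longleftrightarrow> v$2 + v$3 = 0"
  if "v \<noteq> 0" for v
proof -
  have "Ordinary (C + A - B) = bary A B C (vector [1, -1, 1])"
    "Ordinary (A + B - C) = bary A B C (vector [1, 1, -1])"
    by (simp_all add: bary_def mass_def comb_def algebra_simps)
  then have "join (Ordinary (C + A - B)) (Ordinary (A + B - C)) = bline A B C (vector [0, 2, 2])"
    using join_bary(2)[of "vector [1, -1, 1]" "vector [1, 1, -1]"]
    by (simp add: cross_vector eq_zero_3)
  then show ?thesis using that by (auto simp: bary_in_bline_iff inner_vec_def sum_3)
qed

lemma extended_sides_bary:
  assumes "v \<noteq> 0"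
  shows "bary A B C v \<in> extended_sides A B C \<longleftrightarrow> v$1 = 0 \<or> v$2 = 0 \<or> v$3 = 0"
    and "bary A B C v \<in> extended_sides (anticomplement A B C A) (anticomplement A B C B) (anticomplement A B C C)
      \<longleftrightarrow> v$2 + v$3 = 0 \<or> v$3 + v$1 = 0 \<or> v$1 + v$2 = 0"
proof -
  have r: "bary B C A (vector [v$2, v$3, v$1]) = bary A B C v"
    "bary C A B (vector [v$3, v$1, v$2]) = bary A B C v"
    by (simp_all only: bary_rotate vector3_eta[symmetric])
  have nz: "vector [v$2, v$3, v$1] \<noteq> (0 :: real^3)" "vector [v$3, v$1, v$2] \<noteq> (0 :: real^3)"
    using assms by (auto simp: eq_zero_3)
  show "bary A B C v \<in> extended_sides A B C \<longleftrightarrow> v$1 = 0 \<or> v$2 = 0 \<or> v$3 = 0"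
    using side_bary[OF assms] triangle.side_bary[OF rotate(1) nz(1)]
      triangle.side_bary[OF rotate(2) nz(2)]
    unfolding r by (auto simp: extended_sides_def)
  show "bary A B C v \<in> extended_sides (anticomplement A B C A) (anticomplement A B C B) (anticomplement A B C C)
      \<longleftrightarrow> v$2 + v$3 = 0 \<or> v$3 + v$1 = 0 \<or> v$1 + v$2 = 0"
    using anticomplementary_side_bary[OF assms]
      triangle.anticomplementary_side_bary[OF rotate(1) nz(1)]
      triangle.anticomplementary_side_bary[OF rotate(2) nz(2)]
    unfolding r by (auto simp: extended_sides_def anticomplement_eq)
qed

end

theorem theorem2p7:
  fixes A B C :: "real^2" and P :: ext_point
  assumes "\<not> collinear {A, B, C}"
    and "P \<notin> extended_sides A B C"
    and "P \<notin> extended_sides (anticomplement A B C A) (anticomplement A B C B) (anticomplement A B C C)"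
  shows "let G = centroid A B C;
             P' = isotomic_conjugate A B C P;
             T\<^sub>P = cevian_map A B C P;
             T\<^sub>P\<^sub>' = reflected_cevian_map A B C P;
             S' = T\<^sub>P\<^sub>' \<circ> T\<^sub>P \<circ> inv T\<^sub>P\<^sub>' \<circ> inv T\<^sub>P;
             G\<^sub>1 = T\<^sub>P G
         in \<exists>v. S' = (\<lambda>x. x + v)
              \<and> (\<not> (P = Ordinary G \<and> P' = Ordinary G) \<longrightarrow> along v (join P P'))
              \<and> (\<forall>p p'. P = Ordinary p \<and> P' = Ordinary p'
                   \<longrightarrow> norm v = dist (T\<^sub>P p') p' \<and> dist (T\<^sub>P p') p' = dist p (T\<^sub>P\<^sub>' p))
              \<and> (P \<in> line_at_infinity \<or> P' \<in> line_at_infinity \<longrightarrow> norm v = 3 * dist G\<^sub>1 G)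
              \<and> (P = Ordinary G \<and> P' = Ordinary G \<longrightarrow> v = 0)"
proof -
  interpret triangle A B C using assms(1) by unfold_locales
  obtain u where u: "u \<noteq> 0" "P = bary A B C u" by (rule bary_surj)
  define p q r where "p = u$1" and "q = u$2" and "r = u$3"
  have P: "P = bary A B C (vector [p, q, r])"
    using u(2) vector3_eta[of u] by (simp add: p_def q_def r_def)
  interpret triangle_cevian A B C p q r
    using assms(2,3) u extended_sides_bary[OF u(1)]
    by unfold_locales (auto simp: p_def q_def r_def)
  let ?v = "comb A B C (shift p q r)"
  have centroid_bary: "Ordinary (centroid A B C) = bary A B C (vector [1, 1, 1])"
    by (simp add: bary_def mass_def comb_def centroid_def)
  have dir: "along ?v (join P P')" if "\<not> (P = Ordinary (centroid A B C) \<and> P' = Ordinary (centroid A B C))"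
  proof -
    have "P \<noteq> P'"
    proof
      assume eq: "P = P'"
      then have "p = q" "q = r" using P P_eq_P'_imp_equal by auto
      then have "P = Ordinary (centroid A B C)"
        using P bary_scale_vector[of r 1 1 1] nz by (simp add: centroid_bary)
      then show False using eq that by simp
    qed
    then show ?thesis using shift_along_PP' P by simp
  qed
  have ord: "norm ?v = dist (cevian_map A B C P x') x'
      \<and> dist (cevian_map A B C P x') x' = dist x (reflected_cevian_map A B C P x)"
    if "P = Ordinary x" "P' = Ordinary x'" for x x'
  proof -
    have "p + q + r \<noteq> 0" "q * r + r * p + p * q \<noteq> 0"
      using that P by (auto simp: bary_def mass_def split: if_splits)
    then show ?thesis
      using cevian_map_isotomic_conjugate[of x'] reflected_cevian_map_self[of x] that P
      by (simp add: dist_norm)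
  qed
  have cen: "norm ?v = 3 * dist (cevian_map A B C P (centroid A B C)) (centroid A B C)"
    using cevian_map_centroid P by (simp add: dist_norm)
  have zero: "?v = 0" if "P = Ordinary (centroid A B C)" "P' = Ordinary (centroid A B C)"
  proof -
    have "p = q \<and> q = r" using that P P_eq_P'_imp_equal by simp
    then have "shift p q r = 0"
      unfolding shift_components by (simp add: eq_zero_3 power2_eq_square)
    then show ?thesis
      by (simp add: comb_def)
  qed
  show ?thesis
    unfolding Let_def P isotomic_conjugate_eq
    by (rule exI[of _ ?v])
      (use commutator_translation dir ord cen zero P in auto)
qed

end
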